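(* Let $\mathbb{E}_1,\mathbb{E}_2$ be Euclidean spaces, let $U\subset\mathbb{E}_2$ be a nontrivial subspace and let $F:D\to\mathbb{E}_2$ with $D\subset\mathbb{E}_1$ nonempty and convex. Then $F$ is $U$-convex if and only if there exist an affine map $G:\mathrm{aff}\,D\to\mathbb{E}_2$ and a function $H:\mathrm{aff}\,D\to U$ such that $G_{|D}+H_{|D}=F$.
   Context: A Euclidean space is a finite-dimensional real inner product space. A subspace is nontrivial if it is neither $\{0\}$ nor the whole space. For a cone $K\subset\mathbb{E}_2$ (a nonempty set closed under multiplication by all $\lambda\ge0$; here $K=U$) and $F:D\to\mathbb{E}_2$, the $K$-epigraph is $K\text{-}\mathrm{epi}\,F:=\{(x,y)\in D\times\mathbb{E}_2 : y-F(x)\in K\}$, and $F$ is $K$-convex if $K\text{-}\mathrm{epi}\,F$ is convex. $\mathrm{aff}\,D$ is the affine hull of $D$. For a nonempty affine set $A$ and $x_0\in A$, $\mathrm{par}\,A:=A-x_0$, and $G:A\to\mathbb{E}_2$ is affine if there are a linear map $L:\mathrm{par}\,A\to\mathbb{E}_2$ and $b\in\mathbb{E}_2$ with $G(x)=L(x-x_0)+b$ for all $x\in A$. *)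

theory Defs
  imports "HOL-Analysis.Analysis"
begin

text \<open>
  A function with domain \<open>D\<close> is represented by a total function together with the set \<open>D\<close>;
  every notion below depends only on its values on \<open>D\<close>.
\<close>

text \<open>
  The class \<open>euclidean_space\<close> excludes the zero space, which is a legitimate Euclidean space here.
  A Euclidean space is therefore a type of class \<open>real_inner\<close> that satisfies this predicate.
\<close>

definition finite_dim :: "'a::real_vector itself \<Rightarrow> bool" where
  "finite_dim T \<longleftrightarrow> (\<exists>B::'a set. finite B \<and> span B = UNIV)"

definition nontrivial_subspace :: "'a::real_vector set \<Rightarrow> bool" where
  "nontrivial_subspace U \<longleftrightarrow> subspace U \<and> U \<noteq> {0} \<and> U \<noteq> UNIV"

definition K_epi :: "'b::real_vector set \<Rightarrow> 'a::real_vector set \<Rightarrow> ('a \<Rightarrow> 'b) \<Rightarrow> ('a \<times> 'b) set" where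
  "K_epi K D F = {(x, y). x \<in> D \<and> y - F x \<in> K}"

definition K_convex :: "'b::real_vector set \<Rightarrow> 'a::real_vector set \<Rightarrow> ('a \<Rightarrow> 'b) \<Rightarrow> bool" where
  "K_convex K D F \<longleftrightarrow> convex (K_epi K D F)"

definition par :: "'a::real_vector set \<Rightarrow> 'a \<Rightarrow> 'a set" where
  "par A x0 = (\<lambda>x. x - x0) ` A"

text \<open>The library predicate \<open>linear\<close> is only about maps defined on the whole type.\<close>

definition linear_map_on :: "'a::real_vector set \<Rightarrow> ('a \<Rightarrow> 'b::real_vector) \<Rightarrow> bool" where
  "linear_map_on V L \<longleftrightarrow> subspace V \<and>
     (\<forall>u\<in>V. \<forall>v\<in>V. L (u + v) = L u + L v) \<and> (\<forall>c. \<forall>v\<in>V. L (c *\<^sub>R v) = c *\<^sub>R L v)"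

text \<open>
  The base point \<open>x0\<close> is immaterial: changing it within \<open>A\<close> leaves \<open>par A x0\<close> and \<open>L\<close>
  unchanged and only alters \<open>b\<close>.
\<close>

definition affine_map_on :: "'a::real_vector set \<Rightarrow> ('a \<Rightarrow> 'b::real_vector) \<Rightarrow> bool" where
  "affine_map_on A G \<longleftrightarrow> affine A \<and>
     (\<exists>x0\<in>A. \<exists>L b. linear_map_on (par A x0) L \<and> (\<forall>x\<in>A. G x = L (x - x0) + b))"

end

theory Submission
  imports Defs
begin

text \<open>
  For a subspace \<open>U\<close>, \<open>U\<close>-convexity of \<open>F\<close> says that \<open>F\<close> preserves convex combinations modulo \<open>U\<close>
  (\<open>K_convex_subspace_iff\<close>). An affine map preserves them exactly and a \<open>U\<close>-valued map vanishes
  modulo \<open>U\<close>, so \<open>G + H\<close> is \<open>U\<close>-convex.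

  Conversely, let \<open>q\<close> be a linear projection onto \<open>U\<close>. The map \<open>P = F - q \<circ> F\<close> differs from \<open>F\<close> by
  values in \<open>U\<close> and preserves convex combinations on \<open>D\<close> exactly, since \<open>id - q\<close> kills \<open>U\<close>. What
  remains is to extend \<open>P\<close> affinely beyond \<open>D\<close> (\<open>convex_combination_preserving_extends\<close>). After
  translating so that \<open>0 \<in> D\<close> and \<open>P 0 = 0\<close>, the graph of \<open>P\<close> is a convex set containing the origin,
  so its linear span consists of differences of nonnegative multiples of its points
  (\<open>span_convex_with_zero\<close>). This description shows that the span is again the graph of a function,
  which is then linear because its graph is a subspace.
\<close>

section \<open>Convexity modulo a subspace\<close>

lemma K_convex_subspace_iff:
  fixes F :: "'a::real_vector \<Rightarrow> 'b::real_vector"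
  assumes U: "subspace U" and D: "convex D"
  shows "K_convex U D F \<longleftrightarrow>
    (\<forall>x\<in>D. \<forall>y\<in>D. \<forall>s\<ge>0. \<forall>t\<ge>0. s + t = 1 \<longrightarrow>
       F (s *\<^sub>R x + t *\<^sub>R y) - (s *\<^sub>R F x + t *\<^sub>R F y) \<in> U)"
    (is "_ \<longleftrightarrow> ?mod")
proof
  assume conv: "K_convex U D F"
  show ?mod
  proof (intro ballI allI impI)
    fix x y and s t :: real
    assume xy: "x \<in> D" "y \<in> D" and st: "0 \<le> s" "0 \<le> t" "s + t = 1"
    have "(x, F x) \<in> K_epi U D F" "(y, F y) \<in> K_epi U D F"
      using xy subspace_0[OF U] by (auto simp: K_epi_def)
    then have "s *\<^sub>R (x, F x) + t *\<^sub>R (y, F y) \<in> K_epi U D F"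
      using conv st unfolding K_convex_def convex_def by blast
    then have "s *\<^sub>R F x + t *\<^sub>R F y - F (s *\<^sub>R x + t *\<^sub>R y) \<in> U"
      by (simp add: K_epi_def)
    from subspace_neg[OF U this]
    show "F (s *\<^sub>R x + t *\<^sub>R y) - (s *\<^sub>R F x + t *\<^sub>R F y) \<in> U" by simp
  qed
next
  assume mod: ?mod
  show "K_convex U D F"
    unfolding K_convex_def convex_def
  proof (intro ballI allI impI)
    fix p p' :: "'a \<times> 'b" and s t :: real
    assume p: "p \<in> K_epi U D F" "p' \<in> K_epi U D F" and st: "0 \<le> s" "0 \<le> t" "s + t = 1"
    obtain x y x' y' where eq: "p = (x, y)" "p' = (x', y')"
      by (cases p, cases p')
    with p have x: "x \<in> D" "x' \<in> D" and y: "y - F x \<in> U" "y' - F x' \<in> U"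
      by (auto simp: K_epi_def)
    have "F (s *\<^sub>R x + t *\<^sub>R x') - (s *\<^sub>R F x + t *\<^sub>R F x') \<in> U"
      using mod x st by blast
    then have "s *\<^sub>R (y - F x) + t *\<^sub>R (y' - F x')
        - (F (s *\<^sub>R x + t *\<^sub>R x') - (s *\<^sub>R F x + t *\<^sub>R F x')) \<in> U"
      using y by (meson U subspace_diff subspace_add subspace_scale)
    then have "s *\<^sub>R y + t *\<^sub>R y' - F (s *\<^sub>R x + t *\<^sub>R x') \<in> U"
      by (simp add: algebra_simps)
    moreover have "s *\<^sub>R x + t *\<^sub>R x' \<in> D"
      using D x st by (auto simp: convex_def)
    ultimately show "s *\<^sub>R p + t *\<^sub>R p' \<in> K_epi U D F"
      by (simp add: K_epi_def eq)
  qed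
qed

text \<open>
  Weights summing to one reproduce the base point and the constant term, and the linear part
  distributes over the combination.
\<close>

lemma affine_map_on_combination:
  assumes G: "affine_map_on A G" and xy: "x \<in> A" "y \<in> A" and st: "s + t = 1"
  shows "G (s *\<^sub>R x + t *\<^sub>R y) = s *\<^sub>R G x + t *\<^sub>R G y"
proof -
  from G obtain x0 L b where A: "affine A" and L: "linear_map_on (par A x0) L"
    and eq: "\<And>z. z \<in> A \<Longrightarrow> G z = L (z - x0) + b"
    unfolding affine_map_on_def by blast
  have sub: "subspace (par A x0)" and dir: "x - x0 \<in> par A x0" "y - x0 \<in> par A x0"
    using L xy by (auto simp: linear_map_on_def par_def)
  have s: "s = 1 - t" using st by simp
  have in_A: "s *\<^sub>R x + t *\<^sub>R y \<in> A"
    using A xy st by (auto simp: affine_def)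
  have "s *\<^sub>R x + t *\<^sub>R y - x0 = s *\<^sub>R (x - x0) + t *\<^sub>R (y - x0)"
    by (simp add: s algebra_simps)
  then have "L (s *\<^sub>R x + t *\<^sub>R y - x0) = s *\<^sub>R L (x - x0) + t *\<^sub>R L (y - x0)"
    using L dir subspace_scale[OF sub] by (simp add: linear_map_on_def)
  then show ?thesis
    using xy in_A by (simp add: eq s algebra_simps)
qed

section \<open>Affine extension from a convex set\<close>

text \<open>
  Differences of points of the cone over \<open>S\<close> already form a subspace: convexity makes the cone
  closed under addition, and passing to differences makes it closed under negation.
\<close>

lemma span_convex_with_zero:
  fixes S :: "'a::real_vector set"
  assumes S: "convex S" and zero: "0 \<in> S" and z: "z \<in> span S"
  obtains s t u v where "0 \<le> s" "0 \<le> t" "u \<in> S" "v \<in> S" "z = s *\<^sub>R u - t *\<^sub>R v"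
proof -
  define C where "C = {s *\<^sub>R u | s u. 0 \<le> s \<and> u \<in> S}"
  have C_I: "s *\<^sub>R u \<in> C" if "0 \<le> s" "u \<in> S" for s u
    using that by (auto simp: C_def)
  have C_zero: "0 \<in> C"
    using C_I[of 0 0] zero by simp
  have C_add: "a + b \<in> C" if ab: "a \<in> C" "b \<in> C" for a b
  proof -
    from ab obtain s t u v where st: "0 \<le> s" "0 \<le> t" and uv: "u \<in> S" "v \<in> S"
      and eq: "a = s *\<^sub>R u" "b = t *\<^sub>R v"
      unfolding C_def by blast
    show ?thesis
    proof (cases "s + t = 0")
      case True
      with st have "s = 0" "t = 0" by auto
      then show ?thesis using C_zero by (simp add: eq)
    next
      case False
      let ?w = "(s / (s + t)) *\<^sub>R u + (t / (s + t)) *\<^sub>R v"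
      have "?w \<in> S"
        using S uv st False by (intro convexD) (auto simp: add_divide_distrib[symmetric])
      moreover have "(s + t) *\<^sub>R ?w = a + b"
        using False by (simp add: eq scaleR_add_right)
      ultimately show ?thesis
        using C_I[of "s + t" ?w] st by simp
    qed
  qed
  have C_scale: "c *\<^sub>R a \<in> C" if "0 \<le> c" "a \<in> C" for c a
    using that by (auto simp: C_def) (metis mult_nonneg_nonneg)
  let ?V = "{a - b | a b. a \<in> C \<and> b \<in> C}"
  have "subspace ?V"
  proof (rule subspaceI)
    show "0 \<in> ?V" using C_zero by force
  next
    fix x y assume "x \<in> ?V" "y \<in> ?V"
    then obtain a b a' b' where "a \<in> C" "b \<in> C" "a' \<in> C" "b' \<in> C" "x = a - b" "y = a' - b'"
      by blast
    moreover from this have "x + y = (a + a') - (b + b')" by simp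
    ultimately show "x + y \<in> ?V" using C_add by blast
  next
    fix c x assume "x \<in> ?V"
    then obtain a b where ab: "a \<in> C" "b \<in> C" and x: "x = a - b" by blast
    show "c *\<^sub>R x \<in> ?V"
    proof (cases "0 \<le> c")
      case True
      moreover have "c *\<^sub>R x = c *\<^sub>R a - c *\<^sub>R b" by (simp add: x algebra_simps)
      ultimately show ?thesis using C_scale ab by blast
    next
      case False
      then have "0 \<le> - c" by simp
      moreover have "c *\<^sub>R x = (- c) *\<^sub>R b - (- c) *\<^sub>R a" by (simp add: x algebra_simps)
      ultimately show ?thesis using C_scale ab by blast
    qed
  qed
  moreover have "S \<subseteq> ?V"
  proof
    fix u assume "u \<in> S"
    then have "u \<in> C" using C_I[of 1 u] by simp
    then show "u \<in> ?V" using C_zero by force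
  qed
  ultimately have "z \<in> ?V" using z span_minimal by blast
  then show thesis using that by (auto simp: C_def)
qed

text \<open>
  Once the first projection is known to be injective on the span of the graph of \<open>Q\<close>, a linear left
  inverse of it, followed by the second projection, is the required \<open>L\<close>. For injectivity, a vertical
  vector in the span is \<open>(0, s *\<^sub>R Q u - t *\<^sub>R Q v)\<close> with \<open>s *\<^sub>R u = t *\<^sub>R v\<close> and \<open>s, t \<ge> 0\<close>. If
  \<open>t \<le> s\<close> and \<open>s > 0\<close>, then \<open>u = (t / s) *\<^sub>R v\<close> is a convex combination of \<open>v\<close> and \<open>0\<close>, so
  \<open>Q u = (t / s) *\<^sub>R Q v\<close> and the vector vanishes; the case \<open>s \<le> t\<close> is symmetric.
\<close>

lemma convex_combination_preserving_linear:
  fixes Q :: "'a::real_vector \<Rightarrow> 'b::real_vector"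
  assumes S: "convex S" and zero: "0 \<in> S" and Q0: "Q 0 = 0"
    and Q: "\<And>x y s t. \<lbrakk>x \<in> S; y \<in> S; 0 \<le> s; 0 \<le> t; s + t = 1\<rbrakk> \<Longrightarrow>
              Q (s *\<^sub>R x + t *\<^sub>R y) = s *\<^sub>R Q x + t *\<^sub>R Q y"
  obtains L where "linear L" "\<And>x. x \<in> S \<Longrightarrow> L x = Q x"
proof -
  define \<Gamma> where "\<Gamma> = (\<lambda>x. (x, Q x)) ` S"
  have conv: "convex \<Gamma>"
    unfolding convex_def
  proof (intro ballI allI impI)
    fix p p' and s t :: real
    assume p: "p \<in> \<Gamma>" "p' \<in> \<Gamma>" and st: "0 \<le> s" "0 \<le> t" "s + t = 1"
    then obtain x y where xy: "x \<in> S" "y \<in> S" and eq: "p = (x, Q x)" "p' = (y, Q y)"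
      by (auto simp: \<Gamma>_def)
    have "s *\<^sub>R x + t *\<^sub>R y \<in> S" using S xy st by (auto simp: convex_def)
    then show "s *\<^sub>R p + t *\<^sub>R p' \<in> \<Gamma>"
      using Q[OF xy st] by (auto simp: \<Gamma>_def eq)
  qed
  have zero_\<Gamma>: "0 \<in> \<Gamma>"
    using zero Q0 by (force simp: \<Gamma>_def zero_prod_def)
  have shrink: "Q (r *\<^sub>R x) = r *\<^sub>R Q x" if "x \<in> S" "0 \<le> r" "r \<le> 1" for r x
    using Q[OF that(1) zero that(2), of "1 - r"] that Q0 by simp
  have proportional: "s *\<^sub>R Q u = t *\<^sub>R Q v"
    if uv: "u \<in> S" "v \<in> S" and ts: "0 \<le> t" "t \<le> s" and eq: "s *\<^sub>R u = t *\<^sub>R v" for s t u v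
  proof (cases "s = 0")
    case True
    with ts show ?thesis by simp
  next
    case False
    have "u = (1 / s) *\<^sub>R (s *\<^sub>R u)" using False by simp
    also have "\<dots> = (t / s) *\<^sub>R v" by (simp add: eq)
    finally have "u = (t / s) *\<^sub>R v" .
    then have "Q u = (t / s) *\<^sub>R Q v" using shrink[of v "t / s"] uv ts False by simp
    then show ?thesis using False by simp
  qed
  have single: "y = 0" if y_span: "(0, y) \<in> span \<Gamma>" for y
  proof -
    obtain s t p p' where st: "0 \<le> s" "0 \<le> t" and p: "p \<in> \<Gamma>" "p' \<in> \<Gamma>"
      and "(0, y) = s *\<^sub>R p - t *\<^sub>R p'"
      by (rule span_convex_with_zero[OF conv zero_\<Gamma> y_span])
    then obtain u v where uv: "u \<in> S" "v \<in> S" and eq: "s *\<^sub>R u = t *\<^sub>R v"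
      and y: "y = s *\<^sub>R Q u - t *\<^sub>R Q v"
      by (auto simp: \<Gamma>_def)
    have "s *\<^sub>R Q u = t *\<^sub>R Q v"
    proof (cases "t \<le> s")
      case True
      then show ?thesis using proportional uv st eq by blast
    next
      case False
      then show ?thesis using proportional[of v u s t] uv st eq by simp
    qed
    then show ?thesis by (simp add: y)
  qed
  have "inj_on fst (span \<Gamma>)"
  proof (rule inj_onI)
    fix p p' assume p: "p \<in> span \<Gamma>" "p' \<in> span \<Gamma>" and "fst p = fst p'"
    then have "(0, snd p - snd p') \<in> span \<Gamma>"
      using span_diff[OF p] by (cases p, cases p') simp
    then have "snd p = snd p'" using single by fastforce
    with \<open>fst p = fst p'\<close> show "p = p'" by (simp add: prod_eq_iff)
  qed
  then obtain g where g: "linear g" and inv: "\<And>p. p \<in> span \<Gamma> \<Longrightarrow> g (fst p) = p"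
    using linear_exists_left_inverse_on[OF linear_fst subspace_span] by blast
  show thesis
  proof (rule that)
    show "linear (snd \<circ> g)" using g linear_snd by (rule linear_compose)
    fix x assume "x \<in> S"
    then have "(x, Q x) \<in> span \<Gamma>" by (auto simp: \<Gamma>_def intro: span_base)
    from inv[OF this] show "(snd \<circ> g) x = Q x" by simp
  qed
qed

lemma convex_combination_preserving_extends:
  fixes P :: "'a::real_vector \<Rightarrow> 'b::real_vector"
  assumes D: "convex D" and a: "a \<in> D"
    and P: "\<And>x y s t. \<lbrakk>x \<in> D; y \<in> D; 0 \<le> s; 0 \<le> t; s + t = 1\<rbrakk> \<Longrightarrow>
              P (s *\<^sub>R x + t *\<^sub>R y) = s *\<^sub>R P x + t *\<^sub>R P y"
  obtains L where "linear L" "\<And>x. x \<in> D \<Longrightarrow> P x = L (x - a) + P a"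
proof -
  let ?S = "(\<lambda>x. x - a) ` D" and ?Q = "\<lambda>z. P (z + a) - P a"
  have S: "convex ?S" using D by simp
  have zero: "0 \<in> ?S" using a by force
  have Q: "?Q (s *\<^sub>R x + t *\<^sub>R y) = s *\<^sub>R ?Q x + t *\<^sub>R ?Q y"
    if xy: "x \<in> ?S" "y \<in> ?S" and st: "0 \<le> s" "0 \<le> t" "s + t = 1" for x y s t
  proof -
    have s: "s = 1 - t" using st by simp
    have "s *\<^sub>R x + t *\<^sub>R y + a = s *\<^sub>R (x + a) + t *\<^sub>R (y + a)"
      by (simp add: s algebra_simps)
    moreover have "x + a \<in> D" "y + a \<in> D" using xy by auto
    ultimately have "P (s *\<^sub>R x + t *\<^sub>R y + a) = s *\<^sub>R P (x + a) + t *\<^sub>R P (y + a)"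
      using P st by simp
    then show ?thesis by (simp add: s algebra_simps)
  qed
  have Q0: "?Q 0 = 0" by simp
  show thesis
  proof (rule convex_combination_preserving_linear[of ?S ?Q, OF S zero Q0])
    fix L assume "linear L" and L: "\<And>z. z \<in> ?S \<Longrightarrow> L z = ?Q z"
    show thesis
    proof (rule that)
      fix x assume "x \<in> D"
      then show "P x = L (x - a) + P a" using L[of "x - a"] by simp
    qed fact
  qed (rule Q)
qed

lemma affine_map_on_linear_translate:
  assumes A: "affine A" and a: "a \<in> A" and L: "linear L"
  shows "affine_map_on A (\<lambda>x. L (x - a) + b)"
proof -
  have "subspace (par A a)"
    using affine_diffs_subspace_subtract[OF A a] by (simp add: par_def)
  then have "linear_map_on (par A a) L"
    using L by (simp add: linear_map_on_def linear_add linear_scale)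
  then show ?thesis
    using A a unfolding affine_map_on_def by blast
qed

section \<open>The decomposition of \<open>U\<close>-convex maps\<close>

theorem proposition21:
  fixes U :: "'b::real_inner set"
    and D :: "'a::real_inner set"
    and F :: "'a \<Rightarrow> 'b"
  assumes "finite_dim TYPE('a)" and "finite_dim TYPE('b)"
    and "nontrivial_subspace U"
    and "D \<noteq> {}" and "convex D"
  shows "K_convex U D F \<longleftrightarrow>
    (\<exists>G H. affine_map_on (affine hull D) G \<and>
           (\<forall>x \<in> affine hull D. H x \<in> U) \<and>
           (\<forall>x \<in> D. G x + H x = F x))"
proof -
  have U: "subspace U" using assms(3) by (simp add: nontrivial_subspace_def)
  obtain a where a: "a \<in> D" using assms(4) by blast
  note D = assms(5)
  have hull: "x \<in> affine hull D" if "x \<in> D" for x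
    using that by (rule hull_inc)
  show ?thesis
  proof
    assume conv: "K_convex U D F"
    \<comment> \<open>a linear left inverse of the inclusion of \<open>U\<close> is a projection onto \<open>U\<close>\<close>
    obtain q where q_U: "\<And>y. q y \<in> U" and q: "linear q" and q_id: "\<And>u. u \<in> U \<Longrightarrow> q u = u"
      using linear_exists_left_inverse_on[OF linear_id U] by (auto simp: image_subset_iff)
    define P where "P x = F x - q (F x)" for x
    have "P (s *\<^sub>R x + t *\<^sub>R y) = s *\<^sub>R P x + t *\<^sub>R P y"
      if "x \<in> D" "y \<in> D" "0 \<le> s" "0 \<le> t" "s + t = 1" for x y s t
    proof -
      have "F (s *\<^sub>R x + t *\<^sub>R y) - (s *\<^sub>R F x + t *\<^sub>R F y) \<in> U"
        using conv that K_convex_subspace_iff[OF U D] by blast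
      from q_id[OF this] show ?thesis
        by (simp add: P_def linear_diff[OF q] linear_add[OF q] linear_scale[OF q] algebra_simps)
    qed
    from convex_combination_preserving_extends[OF D a this]
    obtain L where L: "linear L" and P_L: "\<And>x. x \<in> D \<Longrightarrow> P x = L (x - a) + P a"
      by blast
    let ?G = "\<lambda>x. L (x - a) + P a"
    \<comment> \<open>outside \<open>D\<close> any element of \<open>U\<close> would serve\<close>
    let ?H = "\<lambda>x. if x \<in> D then q (F x) else 0"
    have "affine_map_on (affine hull D) ?G"
      using affine_affine_hull hull[OF a] L by (rule affine_map_on_linear_translate)
    moreover have "\<forall>x \<in> affine hull D. ?H x \<in> U"
      using q_U subspace_0[OF U] by simp
    moreover have "\<forall>x\<in>D. ?G x + ?H x = F x"
      using P_L[symmetric] by (simp add: P_def)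
    ultimately show "\<exists>G H. affine_map_on (affine hull D) G \<and>
        (\<forall>x \<in> affine hull D. H x \<in> U) \<and> (\<forall>x \<in> D. G x + H x = F x)"
      by (intro exI[of _ ?G] exI[of _ ?H]) blast
  next
    assume "\<exists>G H. affine_map_on (affine hull D) G \<and>
        (\<forall>x \<in> affine hull D. H x \<in> U) \<and> (\<forall>x \<in> D. G x + H x = F x)"
    then obtain G H where G: "affine_map_on (affine hull D) G"
      and H: "\<And>x. x \<in> D \<Longrightarrow> H x \<in> U" and F: "\<And>x. x \<in> D \<Longrightarrow> F x = G x + H x"
      using hull by metis
    show "K_convex U D F"
      unfolding K_convex_subspace_iff[OF U D]
    proof (intro ballI allI impI)
      fix x y and s t :: real
      assume xy: "x \<in> D" "y \<in> D" and st: "0 \<le> s" "0 \<le> t" "s + t = 1"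
      let ?z = "s *\<^sub>R x + t *\<^sub>R y"
      have z: "?z \<in> D" using D xy st by (auto simp: convex_def)
      have "G ?z = s *\<^sub>R G x + t *\<^sub>R G y"
        using affine_map_on_combination[OF G hull hull] xy st by blast
      then have "F ?z - (s *\<^sub>R F x + t *\<^sub>R F y) = H ?z - (s *\<^sub>R H x + t *\<^sub>R H y)"
        by (simp add: F xy z algebra_simps)
      also have "\<dots> \<in> U"
        using H xy z by (intro subspace_diff subspace_add subspace_scale U)
      finally show "F ?z - (s *\<^sub>R F x + t *\<^sub>R F y) \<in> U" .
    qed
  qed
qed

end
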